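(* Let $(x_i)_{i\ge0}$ be a sequence of nonnegative real numbers with $\sum_{i=0}^\infty x_i=1$ and $x_0>0$, and put $y_m=\sum_{j=m}^\infty x_j$. An invariant measure of the Infinite Multivariate Juggling Markov Chain with parameters $(x_i)_{i\ge 0}$ is given by $$w(\lambda)=\prod_{i=1}^\infty y_{\lambda_i},\qquad \lambda\in\mathrm{Par}.$$ Its total mass is $$Z=\prod_{m=1}^\infty\frac{1}{1-y_m},$$ and $Z$ is finite (i.e. the Infinite Multivariate Juggling Markov Chain is positive recurrent) if and only if $\sum_{i=0}^\infty i\,x_i<\infty$.
   Context: $\mathrm{Par}$ is the set of all integer partitions, viewed as non-increasing sequences $\lambda=(\lambda_j)_{j\ge1}$ of nonnegative integers that vanish eventually. For $\lambda\in\mathrm{Par}$ and an integer $i\ge0$, set $$\lambda^{(i)}=(\lambda_1-1,\dots,\lambda_{j-1}-1,\,i,\,\lambda_j,\lambda_{j+1},\dots)$$ with $j$ the smallest index such that $\lambda_j\le i$. The Infinite Multivariate Juggling Markov Chain (IMJMC) is the Markov chain on $\mathrm{Par}$ with transition probabilities $P_{\lambda,\mu}=x_i$ if $\mu=\lambda^{(i)}$ for some $i\ge 0$, and $P_{\lambda,\mu}=0$ otherwise. An invariant measure is a nonzero measure $w$ with $w(\lambda)<\infty$ and $w(\lambda)=\sum_\mu w(\mu)P_{\mu,\lambda}$ for all $\lambda$. When $x_0>0$ the chain has a unique closed communicating class, and the chain is called positive recurrent when that class is positive recurrent. *)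

theory Defs
  imports "HOL-Probability.Probability"
begin

section \<open>Countable-state Markov chains\<close>

text \<open>A time-homogeneous Markov chain is given by its transition kernel \<open>K\<close>;
  the transition probability from \<open>s\<close> to \<open>t\<close> is \<open>pmf (K s) t\<close>.\<close>

text \<open>Joint law of \<open>(X\<^sub>1, \<dots>, X\<^sub>n)\<close> for the chain started at \<open>X\<^sub>0 = s\<close>.\<close>

primrec trajectory :: "('s \<Rightarrow> 's pmf) \<Rightarrow> nat \<Rightarrow> 's \<Rightarrow> 's list pmf" where
  "trajectory K 0 s = return_pmf []"
| "trajectory K (Suc n) s = bind_pmf (K s) (\<lambda>t. map_pmf (\<lambda>ts. t # ts) (trajectory K n t))"

text \<open>The probability that the return time \<open>min {n \<ge> 1. X\<^sub>n = s}\<close> to the starting state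
  \<open>s\<close> equals \<open>n\<close>; it is \<open>0\<close> for \<open>n = 0\<close>, since the event then excludes the empty list.\<close>

definition first_return_prob :: "('s \<Rightarrow> 's pmf) \<Rightarrow> 's \<Rightarrow> nat \<Rightarrow> real" where
  "first_return_prob K s n =
     measure_pmf.prob (trajectory K n s) {us @ [s] | us. s \<notin> set us}"

text \<open>Almost sure return in finite mean time.\<close>

definition positive_recurrent_state :: "('s \<Rightarrow> 's pmf) \<Rightarrow> 's \<Rightarrow> bool" where
  "positive_recurrent_state K s \<longleftrightarrow>
     first_return_prob K s sums 1 \<and> summable (\<lambda>n. real n * first_return_prob K s n)"

definition accessible :: "('s \<Rightarrow> 's pmf) \<Rightarrow> 's \<Rightarrow> 's \<Rightarrow> bool" where
  "accessible K = (\<lambda>s t. t \<in> set_pmf (K s))\<^sup>*\<^sup>*"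

definition communicating_class :: "('s \<Rightarrow> 's pmf) \<Rightarrow> 's set \<Rightarrow> bool" where
  "communicating_class K C \<longleftrightarrow> (\<exists>s. C = {t. accessible K s t \<and> accessible K t s})"

definition closed_communicating_class :: "('s \<Rightarrow> 's pmf) \<Rightarrow> 's set \<Rightarrow> bool" where
  "closed_communicating_class K C \<longleftrightarrow>
     communicating_class K C \<and> (\<forall>s\<in>C. \<forall>t. accessible K s t \<longrightarrow> t \<in> C)"

text \<open>The chain has exactly one closed communicating class, and all states of that class are
  positive recurrent.\<close>

definition positive_recurrent_chain :: "('s \<Rightarrow> 's pmf) \<Rightarrow> bool" where
  "positive_recurrent_chain K \<longleftrightarrow>
     (\<exists>C. (\<forall>D. closed_communicating_class K D \<longleftrightarrow> D = C) \<and>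
          (\<forall>s\<in>C. positive_recurrent_state K s))"

text \<open>A measure on the discrete state space is given by its point masses.\<close>

definition invariant_measure :: "('s \<Rightarrow> 's pmf) \<Rightarrow> ('s \<Rightarrow> ennreal) \<Rightarrow> bool" where
  "invariant_measure K w \<longleftrightarrow>
     (\<exists>s. w s \<noteq> 0) \<and> (\<forall>s. w s < \<infinity>) \<and>
     (\<forall>t. w t = (\<integral>\<^sup>+ s. w s * ennreal (pmf (K s) t) \<partial>count_space UNIV))"

definition total_mass :: "('s \<Rightarrow> ennreal) \<Rightarrow> ennreal" where
  "total_mass w = (\<integral>\<^sup>+ s. w s \<partial>count_space UNIV)"


section \<open>Integer partitions\<close>

text \<open>Indices start at \<open>0\<close>: \<open>part l j\<close> is the part \<open>\<lambda>\<^sub>j\<^sub>+\<^sub>1\<close>.\<close>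

typedef par = "{l :: nat \<Rightarrow> nat. antimono l \<and> (\<forall>\<^sub>F j in sequentially. l j = 0)}"
  morphisms part Par
  by (rule exI[of _ "\<lambda>_. 0"]) (simp add: antimono_def)

setup_lifting type_definition_par

definition throw_seq :: "nat \<Rightarrow> (nat \<Rightarrow> nat) \<Rightarrow> nat \<Rightarrow> nat" where
  "throw_seq i l =
     (let j = (LEAST j. l j \<le> i)
      in (\<lambda>k. if k < j then l k - 1 else if k = j then i else l (k - 1)))"

lemma throw_seq_closed:
  assumes "antimono l" and "\<forall>\<^sub>F j in sequentially. l j = 0"
  shows "antimono (throw_seq i l) \<and> (\<forall>\<^sub>F j in sequentially. throw_seq i l j = 0)"
proof -
  define j where "j = (LEAST j. l j \<le> i)"
  obtain N where N: "l k = 0" if "k \<ge> N" for k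
    using assms(2) by (auto simp: eventually_sequentially)
  have le: "l j \<le> i"
    unfolding j_def by (rule LeastI[of _ N]) (simp add: N)
  have gt: "l k > i" if "k < j" for k
    using not_less_Least[of k "\<lambda>j. l j \<le> i"] that by (simp add: j_def)
  have mono: "l b \<le> l a" if "a \<le> b" for a b
    using assms(1) that by (auto simp: antimono_def)
  have eq: "throw_seq i l k = (if k < j then l k - 1 else if k = j then i else l (k - 1))" for k
    by (simp add: throw_seq_def Let_def j_def)
  have "throw_seq i l (Suc k) \<le> throw_seq i l k" for k
  proof -
    consider "Suc k < j" | "Suc k = j" | "k = j" | "k > j" by linarith
    then show ?thesis
    proof cases
      case 1
      then show ?thesis using mono[of k "Suc k"] by (simp add: eq)
    next
      case 2
      then show ?thesis using gt[of k] by (simp add: eq)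
    next
      case 3
      then show ?thesis using le by (simp add: eq)
    next
      case 4
      then show ?thesis using mono[of "k - 1" k] by (simp add: eq)
    qed
  qed
  then have "antimono (throw_seq i l)"
    by (rule decseq_SucI)
  moreover have "throw_seq i l k = 0" if "k \<ge> Suc (max N j)" for k
    using that by (auto simp: eq N)
  ultimately show ?thesis
    by (auto simp: eventually_sequentially)
qed

text \<open>The partition \<open>\<lambda>\<^sup>(\<^sup>i\<^sup>)\<close>.\<close>

lift_definition throw :: "nat \<Rightarrow> par \<Rightarrow> par" is throw_seq
  by (rule throw_seq_closed) auto

lemma part_throw:
  assumes "j = (LEAST j. part l j \<le> i)"
  shows "part (throw i l) k =
    (if k < j then part l k - 1 else if k = j then i else part l (k - 1))"
  unfolding assms by transfer (simp add: throw_seq_def Let_def)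

lemma inj_throw: "inj (\<lambda>i. throw i l)"
proof -
  have ne: "throw i l \<noteq> throw i' l" if less: "i < i'" for i i'
  proof
    assume eq: "throw i l = throw i' l"
    define j where "j = (LEAST j. part l j \<le> i)"
    define j' where "j' = (LEAST j. part l j \<le> i')"
    have "\<forall>\<^sub>F k in sequentially. part l k = 0"
      using part[of l] by simp
    then obtain N where "part l N = 0"
      by (auto simp: eventually_sequentially)
    then have "part l N \<le> i" by simp
    then have "part l j \<le> i"
      unfolding j_def by (rule LeastI)
    then have *: "part l j \<le> i'"
      using less by simp
    have j': "part l j' \<le> i'" "j' \<le> j"
      unfolding j'_def using * by (rule LeastI, rule Least_le)
    have "part (throw i l) j' = (if j' < j then part l j' - 1 else i)"
      using j' by (simp add: part_throw[OF j_def])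
    also have "\<dots> < i'"
    proof (cases "j' < j")
      case True
      then have "part l j' > i"
        using not_less_Least[of j' "\<lambda>j. part l j \<le> i"] by (simp add: j_def)
      then show ?thesis using j'(1) True by simp
    qed (use less in simp)
    finally show False
      by (simp add: eq part_throw[OF j'_def])
  qed
  show ?thesis
  proof (rule injI)
    fix i i' assume "throw i l = throw i' l"
    then show "i = i'"
      using ne[of i i'] ne[of i' i] by (metis linorder_neqE_nat)
  qed
qed


section \<open>The infinite multivariate juggling Markov chain\<close>

text \<open>The index \<open>i\<close> below is unique by \<open>inj_throw\<close>.\<close>

definition imjmc_matrix :: "(nat \<Rightarrow> real) \<Rightarrow> par \<Rightarrow> par \<Rightarrow> real" where
  "imjmc_matrix x l m = (if \<exists>i. m = throw i l then x (THE i. m = throw i l) else 0)"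

definition imjmc :: "(nat \<Rightarrow> real) \<Rightarrow> par \<Rightarrow> par pmf" where
  "imjmc x l = embed_pmf (imjmc_matrix x l)"

lemma imjmc_matrix_throw: "imjmc_matrix x l (throw i l) = x i"
proof -
  have "(THE i'. throw i l = throw i' l) = i"
    by (rule the_equality) (auto dest: injD[OF inj_throw])
  then show ?thesis
    by (auto simp: imjmc_matrix_def)
qed

text \<open>For a probability sequence \<open>x\<close> the matrix is stochastic, so \<open>imjmc x\<close> has exactly
  the prescribed transition probabilities.\<close>

lemma pmf_imjmc:
  assumes "\<And>i. x i \<ge> 0" and "x sums 1"
  shows "pmf (imjmc x l) m = imjmc_matrix x l m"
  unfolding imjmc_def
proof (rule pmf_embed_pmf)
  show "0 \<le> imjmc_matrix x l m" for m
    using assms(1) by (simp add: imjmc_matrix_def)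
  have "(\<integral>\<^sup>+ m. ennreal (imjmc_matrix x l m) \<partial>count_space UNIV) =
      (\<integral>\<^sup>+ m. ennreal (imjmc_matrix x l m) * indicator (range (\<lambda>i. throw i l)) m
        \<partial>count_space UNIV)"
    by (intro nn_integral_cong) (auto simp: imjmc_matrix_def indicator_def)
  also have "\<dots> = (\<integral>\<^sup>+ m. ennreal (imjmc_matrix x l m) \<partial>count_space (range (\<lambda>i. throw i l)))"
    by (rule nn_integral_count_space_indicator[symmetric]) simp
  also have "\<dots> = (\<integral>\<^sup>+ i. ennreal (imjmc_matrix x l (throw i l)) \<partial>count_space UNIV)"
    by (rule nn_integral_bij_count_space[symmetric]) (simp add: bij_betw_def inj_throw)
  also have "\<dots> = (\<Sum>i. ennreal (x i))"
    by (simp add: imjmc_matrix_throw nn_integral_count_space_nat)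
  also have "\<dots> = ennreal 1"
    using assms by (intro suminf_ennreal_eq) auto
  finally show "(\<integral>\<^sup>+ m. ennreal (imjmc_matrix x l m) \<partial>count_space UNIV) = 1"
    by simp
qed

definition tail_sum :: "(nat \<Rightarrow> real) \<Rightarrow> nat \<Rightarrow> real" where
  "tail_sum x m = (\<Sum>j. x (m + j))"

definition juggling_weight :: "(nat \<Rightarrow> real) \<Rightarrow> par \<Rightarrow> real" where
  "juggling_weight x l = (\<Prod>i. tail_sum x (part l i))"

end

theory Submission
  imports Defs
begin

text \<open>The predecessors of \<open>\<lambda>\<close> are obtained by choosing a position \<open>j\<close>, deleting the part \<open>\<lambda>\<^sub>j\<close> and
  raising the earlier parts by one. Since \<open>x\<^sub>i = y\<^sub>i - y\<^sub>i\<^sub>+\<^sub>1\<close>, the balance equation telescopes over \<open>j\<close>,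
  and the boundary term vanishes because \<open>y\<^sub>1 < 1\<close>. The total mass factors over the multiplicities of
  the part sizes, one geometric series for each size; the resulting product is finite iff
  \<open>\<Sum>\<^sub>m\<^sub>\<ge>\<^sub>1 y\<^sub>m = \<Sum>\<^sub>i i x\<^sub>i\<close> is, as \<open>1 + y \<le> 1 / (1 - y) \<le> exp (y / x\<^sub>0)\<close> for \<open>0 \<le> y \<le> 1 - x\<^sub>0\<close>.

  For positive recurrence, an invariant measure \<open>w\<close> of any chain dominates \<open>w(s)\<close> times the expected
  number of visits during an excursion from \<open>s\<close>, and the latter has total mass the mean return time.
  If \<open>s\<close> is recurrent and accessible from everywhere, the two measures agree. Here the empty partition
  is accessible from everywhere by repeatedly throwing at height \<open>0\<close>.\<close>

section \<open>Series, products and integrals\<close>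

text \<open>The type \<open>'b\<close> may be uncountable, so \<open>count_space UNIV\<close> need
  not be sigma-finite. Restricting to the countable support of \<open>p\<close> reduces the exchange
  to a countable sum against an integral.\<close>

lemma nn_integral_pmf_count_space_swap:
  fixes f :: "'a \<Rightarrow> 'b \<Rightarrow> ennreal"
  shows "(\<integral>\<^sup>+ x. \<integral>\<^sup>+ u. f x u \<partial>count_space UNIV \<partial>measure_pmf p) =
    (\<integral>\<^sup>+ u. \<integral>\<^sup>+ x. f x u \<partial>measure_pmf p \<partial>count_space UNIV)"
proof -
  have supp: "(\<integral>\<^sup>+ x. g x \<partial>measure_pmf p) = (\<integral>\<^sup>+ x. ennreal (pmf p x) * g x \<partial>count_space (set_pmf p))"
    for g :: "'a \<Rightarrow> ennreal"
    unfolding nn_integral_measure_pmf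
    by (rule nn_integral_count_space_eq) (auto simp: set_pmf_iff)
  show ?thesis
    unfolding supp
    using nn_integral_count_space_nn_integral[of "set_pmf p" "\<lambda>x u. ennreal (pmf p x) * f x u" "count_space UNIV"]
    by (simp add: nn_integral_cmult)
qed

text \<open>Exchange of a nonnegative double sum: \<open>x i\<close> is counted once for every
  \<open>m < i\<close>. It serves both the mean return time and the criterion in terms of
  \<open>real i * x i\<close>.\<close>

lemma suminf_tail_sums:
  fixes x :: "nat \<Rightarrow> real"
  assumes nonneg: "\<And>i. x i \<ge> 0" and "summable x"
  shows "(\<Sum>m. ennreal (\<Sum>j. x (Suc m + j))) = (\<Sum>i. ennreal (real i * x i))"
proof -
  have tail: "ennreal (\<Sum>j. x (Suc m + j)) = (\<Sum>i. if m < i then ennreal (x i) else 0)" for m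
  proof -
    have "(\<Sum>j. ennreal (x (Suc m + j))) = ennreal (\<Sum>j. x (Suc m + j))"
      using assms summable_iff_shift[of x "Suc m"]
      by (intro suminf_ennreal2) (auto simp: add.commute)
    moreover have "(\<Sum>i. if m < i then ennreal (x i) else 0) =
        (\<Sum>j. if m < j + Suc m then ennreal (x (j + Suc m)) else 0)"
      by (subst suminf_offset[of _ "Suc m"]) auto
    ultimately show ?thesis
      by (simp add: add.commute)
  qed
  have "(\<Sum>m. ennreal (\<Sum>j. x (Suc m + j))) = (\<Sum>i. \<Sum>m. if m < i then ennreal (x i) else 0)"
    unfolding tail unfolding nn_integral_count_space_nat[symmetric]
    by (rule nn_integral_count_space_nn_integral) auto
  also have "\<dots> = (\<Sum>i. ennreal (real i * x i))"
  proof (intro suminf_cong)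
    fix i
    show "(\<Sum>m. if m < i then ennreal (x i) else 0) = ennreal (real i * x i)"
      by (subst suminf_finite[of "{..<i}"]) (auto simp: nonneg ennreal_mult ennreal_of_nat_eq_real_of_nat)
  qed
  finally show ?thesis .
qed

lemma summable_iff_suminf_ennreal:
  fixes f :: "nat \<Rightarrow> real"
  assumes "\<And>i. f i \<ge> 0"
  shows "summable f \<longleftrightarrow> (\<Sum>i. ennreal (f i)) < \<infinity>"
proof
  assume "summable f"
  then show "(\<Sum>i. ennreal (f i)) < \<infinity>"
    using suminf_ennreal2[OF assms] by simp
next
  assume "(\<Sum>i. ennreal (f i)) < \<infinity>"
  then show "summable f"
    by (intro summable_suminf_not_top assms) auto
qed

text \<open>The library's uniqueness of infinite products needs a cancellative multiplication, which
  \<open>ennreal\<close> lacks.\<close>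

lemma prodinf_ennreal_eqI:
  fixes f :: "nat \<Rightarrow> ennreal"
  assumes lim: "(\<lambda>n. \<Prod>m\<le>n. f m) \<longlonglongrightarrow> p" and "p \<noteq> 0" and nz: "\<And>m. f m \<noteq> 0"
  shows "prodinf f = p"
proof -
  have "f has_prod p"
    using lim \<open>p \<noteq> 0\<close> by (simp add: has_prod_def raw_has_prod_def)
  moreover have "q = p" if "f has_prod q" for q
  proof -
    \<comment> \<open>No factor is zero, which excludes the disjunct of \<open>has_prod_def\<close>
      for products with a vanishing factor.\<close>
    have "raw_has_prod f 0 q"
      using that nz unfolding has_prod_def by blast
    then have "(\<lambda>n. \<Prod>m\<le>n. f m) \<longlonglongrightarrow> q"
      by (simp add: raw_has_prod_def)
    then show ?thesis
      using lim by (rule LIMSEQ_unique)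
  qed
  ultimately show ?thesis
    unfolding prodinf_def by (rule the_equality)
qed

section \<open>Excursions and invariant measures\<close>

definition survival :: "('s \<Rightarrow> 's pmf) \<Rightarrow> 's \<Rightarrow> nat \<Rightarrow> real" where
  "survival K s n = measure_pmf.prob (trajectory K n s) {ts. s \<notin> set ts}"

text \<open>The probability that \<open>X\<^sub>n\<^sub>+\<^sub>1 = t\<close> while \<open>X\<^sub>1, \<dots>, X\<^sub>n\<close> avoid the starting state \<open>s\<close>.\<close>

definition taboo :: "('s \<Rightarrow> 's pmf) \<Rightarrow> 's \<Rightarrow> nat \<Rightarrow> 's \<Rightarrow> ennreal" where
  "taboo K s n t = (\<integral>\<^sup>+ ts. indicator {ts. s \<notin> set ts} ts * ennreal (pmf (K (last (s # ts))) t)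
     \<partial>measure_pmf (trajectory K n s))"

text \<open>\<open>trajectory\<close> peels off the first step, whereas avoiding \<open>s\<close> up
  to time \<open>n\<close> is continued at the end of the path. Writing \<open>last (s # ts)\<close>
  covers the empty path as well.\<close>

lemma trajectory_snoc:
  "trajectory K (Suc n) s =
    bind_pmf (trajectory K n s) (\<lambda>ts. map_pmf (\<lambda>u. ts @ [u]) (K (last (s # ts))))"
proof (induction n arbitrary: s)
  case 0
  then show ?case
    by (simp add: bind_return_pmf map_pmf_def)
next
  case (Suc n)
  show ?case
    by (subst trajectory.simps(2), subst Suc.IH, simp only: trajectory.simps(2))
       (simp add: map_pmf_def bind_assoc_pmf bind_return_pmf last_ConsR)
qed

lemma survival_0 [simp]: "survival K s 0 = 1"
  by (simp add: survival_def)

lemma survival_nonneg: "survival K s n \<ge> 0"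
  by (simp add: survival_def)

lemma ennreal_survival:
  "ennreal (survival K s n) = (\<integral>\<^sup>+ ts. indicator {ts. s \<notin> set ts} ts \<partial>measure_pmf (trajectory K n s))"
  by (simp add: survival_def measure_pmf.emeasure_eq_measure)

lemma taboo_0: "taboo K s 0 t = ennreal (pmf (K s) t)"
  by (simp add: taboo_def)

text \<open>Decompose by the last intermediate state \<open>u\<close>, the one at time
  \<open>Suc n\<close>. The case \<open>u = s\<close> drops out because the longer path has to avoid
  \<open>s\<close>.\<close>

lemma taboo_Suc:
  "taboo K s (Suc n) t =
    (\<integral>\<^sup>+ u. (if u = s then 0 else taboo K s n u) * ennreal (pmf (K u) t) \<partial>count_space UNIV)"
proof -
  have "taboo K s (Suc n) t = (\<integral>\<^sup>+ ts. \<integral>\<^sup>+ u.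
      indicator {ts. s \<notin> set ts} ts * ennreal (pmf (K (last (s # ts))) u) *
      ((if u = s then 0 else 1) * ennreal (pmf (K u) t)) \<partial>count_space UNIV
          \<partial>measure_pmf (trajectory K n s))"
  proof -
    have "(\<integral>\<^sup>+ u. indicator {ts. s \<notin> set ts} (ts @ [u]) * ennreal (pmf (K (last (s # ts @ [u]))) t)
        \<partial>measure_pmf q) =
      (\<integral>\<^sup>+ u. indicator {ts. s \<notin> set ts} ts * ennreal (pmf q u) *
        ((if u = s then 0 else 1) * ennreal (pmf (K u) t)) \<partial>count_space UNIV)" for ts q
      unfolding nn_integral_measure_pmf
      by (intro nn_integral_cong) (auto simp: indicator_def)
    then show ?thesis
      unfolding taboo_def trajectory_snoc nn_integral_bind_pmf nn_integral_map_pmf by simp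
  qed
  also have "\<dots> = (\<integral>\<^sup>+ u. \<integral>\<^sup>+ ts.
      indicator {ts. s \<notin> set ts} ts * ennreal (pmf (K (last (s # ts))) u) *
      ((if u = s then 0 else 1) * ennreal (pmf (K u) t)) \<partial>measure_pmf (trajectory K n s)
          \<partial>count_space UNIV)"
    by (rule nn_integral_pmf_count_space_swap)
  also have "\<dots> =
      (\<integral>\<^sup>+ u. taboo K s n u * ((if u = s then 0 else 1) * ennreal (pmf (K u) t)) \<partial>count_space UNIV)"
    unfolding taboo_def by (simp add: nn_integral_multc)
  also have "\<dots> = (\<integral>\<^sup>+ u. (if u = s then 0 else taboo K s n u) * ennreal (pmf (K u) t) \<partial>count_space UNIV)"
    by (intro nn_integral_cong) auto
  finally show ?thesis .
qed

lemma nn_integral_taboo: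
  "(\<integral>\<^sup>+ t. taboo K s n t \<partial>count_space UNIV) = ennreal (survival K s n)"
proof -
  have "(\<integral>\<^sup>+ t. taboo K s n t \<partial>count_space UNIV) =
      (\<integral>\<^sup>+ ts. \<integral>\<^sup>+ t. indicator {ts. s \<notin> set ts} ts * ennreal (pmf (K (last (s # ts))) t)
        \<partial>count_space UNIV \<partial>measure_pmf (trajectory K n s))"
    unfolding taboo_def by (rule nn_integral_pmf_count_space_swap[symmetric])
  also have "\<dots> = ennreal (survival K s n)"
    unfolding ennreal_survival by (simp add: nn_integral_cmult nn_integral_pmf del: nn_integral_indicator)
  finally show ?thesis .
qed

section \<open>First return probabilities and the mean return time\<close>

lemma first_return_prob_nonneg: "first_return_prob K s n \<ge> 0"
  by (simp add: first_return_prob_def)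

lemma first_return_prob_0: "first_return_prob K s 0 = 0"
  by (simp add: first_return_prob_def)

lemma ennreal_first_return_prob_Suc: "ennreal (first_return_prob K s (Suc n)) = taboo K s n s"
proof -
  have *: "emeasure (measure_pmf (map_pmf (\<lambda>u. ts @ [u]) q)) {us @ [s] | us. s \<notin> set us} =
     indicator {ts. s \<notin> set ts} ts * ennreal (pmf q s)" for q :: "'a pmf" and ts
  proof -
    have "(\<lambda>u. ts @ [u]) -` {us @ [s] | us. s \<notin> set us} = (if s \<in> set ts then {} else {s})"
      by auto
    then show ?thesis
      by (simp add: emeasure_pmf_single indicator_def)
  qed
  show ?thesis
    unfolding first_return_prob_def taboo_def measure_pmf.emeasure_eq_measure[symmetric]
    by (simp only: trajectory_snoc emeasure_bind_pmf *)
qed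

lemma first_return_prob_Suc:
  "first_return_prob K s (Suc n) = survival K s n - survival K s (Suc n)"
proof -
  have *: "(\<integral>\<^sup>+ u. indicator {ts. s \<notin> set ts} (ts @ [u]) \<partial>measure_pmf q) +
     indicator {ts. s \<notin> set ts} ts * ennreal (pmf q s) = indicator {ts. s \<notin> set ts} ts"
     for q :: "'a pmf" and ts
  \<comment> \<open>If the path has avoided \<open>s\<close> so far, its next step either keeps
    avoiding \<open>s\<close> or is the first return.\<close>
  proof (cases "s \<in> set ts")
    case False
    have "emeasure (measure_pmf q) (- {s}) + emeasure (measure_pmf q) {s} = 1"
      by (subst plus_emeasure) (auto simp: Compl_partition2 simp del: Un_insert_right)
    moreover have "(\<lambda>u. indicator {ts. s \<notin> set ts} (ts @ [u]) :: ennreal) = indicator (- {s})"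
      using False by (auto simp: indicator_def)
    ultimately show ?thesis
      using False by (simp add: emeasure_pmf_single)
  qed (simp add: indicator_def)
  have "ennreal (survival K s (Suc n)) + taboo K s n s = ennreal (survival K s n)"
    unfolding ennreal_survival taboo_def trajectory_snoc nn_integral_bind_pmf nn_integral_map_pmf
    by (subst nn_integral_add[symmetric]) (simp_all only: *, auto)
  then have "ennreal (survival K s (Suc n) + first_return_prob K s (Suc n)) = ennreal (survival K s n)"
    by (simp only: ennreal_first_return_prob_Suc[symmetric] ennreal_plus survival_nonneg first_return_prob_nonneg)
  then have "survival K s (Suc n) + first_return_prob K s (Suc n) = survival K s n"
    by (subst (asm) ennreal_inj) (simp_all add: survival_nonneg first_return_prob_nonneg add_nonneg_nonneg)
  then show ?thesis
    by simp
qed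

lemma sum_first_return_prob: "(\<Sum>n\<le>N. first_return_prob K s n) = 1 - survival K s N"
  by (induction N) (auto simp: first_return_prob_0 first_return_prob_Suc)

lemma first_return_prob_sums_1_iff:
  "first_return_prob K s sums 1 \<longleftrightarrow> survival K s \<longlonglongrightarrow> 0"
proof -
  have "first_return_prob K s sums 1 \<longleftrightarrow> (\<lambda>N. 1 - survival K s N) \<longlonglongrightarrow> 1"
    by (simp add: sums_def_le sum_first_return_prob)
  also have "\<dots> \<longleftrightarrow> survival K s \<longlonglongrightarrow> 0"
    using tendsto_diff[of "\<lambda>_. 1" 1 sequentially "\<lambda>N. 1 - survival K s N" 1]
      tendsto_diff[of "\<lambda>_. 1" 1 sequentially "survival K s" 0] by auto
  finally show ?thesis .
qed

text \<open>For an almost surely finite return time, the mean is the sum of the probabilities of not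
  having returned by time \<open>n\<close>. Conversely, summability forces
  \<open>survival K s\<close> to tend to 0, so almost sure return is implied by the right-hand
  side.\<close>

lemma positive_recurrent_state_iff:
  "positive_recurrent_state K s \<longleftrightarrow> (\<Sum>n. ennreal (survival K s n)) < \<infinity>"
proof -
  have mean: "(\<Sum>n. ennreal (survival K s n)) = (\<Sum>n. ennreal (real n * first_return_prob K s n))"
    if sums: "first_return_prob K s sums 1"
  proof -
    have summable: "summable (first_return_prob K s)" and total: "suminf (first_return_prob K s) = 1"
      using sums by (simp_all add: sums_iff)
    have tail: "(\<Sum>j. first_return_prob K s (Suc m + j)) = survival K s m" for m
    proof -
      have "1 = (\<Sum>j. first_return_prob K s (j + Suc m)) + (1 - survival K s m)"
        using suminf_split_initial_segment[OF summable, of "Suc m"]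
        by (simp only: lessThan_Suc_atMost sum_first_return_prob total)
      then show ?thesis
        by (simp only: add.commute[of "Suc m"])
    qed
    show ?thesis
      using suminf_tail_sums[OF first_return_prob_nonneg summable] by (simp only: tail)
  qed
  have return: "first_return_prob K s sums 1" if "(\<Sum>n. ennreal (survival K s n)) < \<infinity>"
  proof -
    have "summable (survival K s)"
      using that summable_iff_suminf_ennreal[of "survival K s", OF survival_nonneg] by blast
    then show ?thesis
      unfolding first_return_prob_sums_1_iff by (rule summable_LIMSEQ_zero)
  qed
  have "summable (\<lambda>n. real n * first_return_prob K s n) \<longleftrightarrow>
      (\<Sum>n. ennreal (real n * first_return_prob K s n)) < \<infinity>"
    by (rule summable_iff_suminf_ennreal) (simp add: first_return_prob_nonneg)
  then show ?thesis
    unfolding positive_recurrent_state_def using mean return by metis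
qed

text \<open>Expected visits up to and including the first return, so \<open>s\<close> itself is counted at the return
  and not at time \<open>0\<close>.\<close>

definition excursion_measure :: "('s \<Rightarrow> 's pmf) \<Rightarrow> 's \<Rightarrow> 's \<Rightarrow> ennreal" where
  "excursion_measure K s t = (\<Sum>n. taboo K s n t)"

lemma total_mass_excursion_measure:
  "total_mass (excursion_measure K s) = (\<Sum>n. ennreal (survival K s n))"
  unfolding total_mass_def excursion_measure_def
  by (subst nn_integral_suminf) (auto simp: nn_integral_taboo)

text \<open>A visit at time 1 comes from the start \<open>s\<close>, which has weight 1; every later
  one comes from a state other than \<open>s\<close>, since the excursion ends there. Hence this
  becomes the balance equation once \<open>excursion_measure K s s = 1\<close>.\<close>

lemma excursion_measure_step:
  "excursion_measure K s t = ennreal (pmf (K s) t) +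
    (\<integral>\<^sup>+ u. (if u = s then 0 else excursion_measure K s u) * ennreal (pmf (K u) t) \<partial>count_space UNIV)"
proof -
  have "excursion_measure K s t = taboo K s 0 t + (\<Sum>n. taboo K s (Suc n) t)"
    unfolding excursion_measure_def by (subst suminf_offset[of _ 1]) auto
  also have "(\<Sum>n. taboo K s (Suc n) t) =
     (\<integral>\<^sup>+ u. (\<Sum>n. (if u = s then 0 else taboo K s n u) * ennreal (pmf (K u) t)) \<partial>count_space UNIV)"
    unfolding taboo_Suc by (subst nn_integral_suminf) auto
  also have "\<dots> =
      (\<integral>\<^sup>+ u. (if u = s then 0 else excursion_measure K s u) * ennreal (pmf (K u) t) \<partial>count_space UNIV)"
    by (intro nn_integral_cong) (auto simp: excursion_measure_def)
  finally show ?thesis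
    by (simp add: taboo_0)
qed

lemma excursion_measure_return:
  assumes "first_return_prob K s sums 1"
  shows "excursion_measure K s s = 1"
proof -
  have "(\<lambda>n. first_return_prob K s (Suc n)) sums 1"
    using assms by (simp add: sums_Suc_iff first_return_prob_0)
  then have "(\<Sum>n. ennreal (first_return_prob K s (Suc n))) = ennreal 1"
    by (intro suminf_ennreal_eq) (auto simp: first_return_prob_nonneg)
  then show ?thesis
    by (simp add: excursion_measure_def ennreal_first_return_prob_Suc)
qed

lemma nn_integral_count_space_split_point:
  fixes f :: "'a \<Rightarrow> ennreal"
  shows "(\<integral>\<^sup>+ u. f u \<partial>count_space UNIV) = f s + (\<integral>\<^sup>+ u. (if u = s then 0 else f u) \<partial>count_space UNIV)"
proof -
  have "(\<integral>\<^sup>+ u. f u \<partial>count_space UNIV) =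
     (\<integral>\<^sup>+ u. f u * indicator {s} u + (if u = s then 0 else f u) \<partial>count_space UNIV)"
    by (intro nn_integral_cong) auto
  then show ?thesis
    by (simp add: nn_integral_add)
qed

text \<open>Iterate the balance equation, each time expanding only the mass outside
  \<open>s\<close>. This produces the expected visits in the first \<open>n\<close> steps of an
  excursion and a nonnegative remainder; the induction bounds these partial sums for all
  \<open>t\<close> at once.\<close>

lemma invariant_measure_ge_excursion_measure:
  assumes "invariant_measure K w"
  shows "w s * excursion_measure K s t \<le> w t"
proof -
  have inv: "w t = (\<integral>\<^sup>+ u. w u * ennreal (pmf (K u) t) \<partial>count_space UNIV)" for t
    using assms unfolding invariant_measure_def by blast
  have partial: "w s * (\<Sum>k<n. taboo K s k t) \<le> w t" for n t
  proof (induction n arbitrary: t)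
    case (Suc n)
    have "w s * (\<Sum>k<Suc n. taboo K s k t) = w s * ennreal (pmf (K s) t) +
      w s * (\<Sum>k<n. \<integral>\<^sup>+ u. (if u = s then 0 else taboo K s k u) * ennreal (pmf (K u) t)
          \<partial>count_space UNIV)"
      by (simp only: sum.lessThan_Suc_shift taboo_0 taboo_Suc distrib_left)
    also have "(\<Sum>k<n. \<integral>\<^sup>+ u. (if u = s then 0 else taboo K s k u) * ennreal (pmf (K u) t)
        \<partial>count_space UNIV) =
       (\<integral>\<^sup>+ u. (if u = s then 0 else (\<Sum>k<n. taboo K s k u)) * ennreal (pmf (K u) t) \<partial>count_space UNIV)"
      by (subst nn_integral_sum[symmetric]) (auto simp: sum_distrib_right intro!: nn_integral_cong)
    also have "w s * \<dots> =
       (\<integral>\<^sup>+ u. (if u = s then 0 else (w s * (\<Sum>k<n. taboo K s k u)) * ennreal (pmf (K u) t))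
           \<partial>count_space UNIV)"
      by (subst nn_integral_cmult[symmetric]) (auto simp: mult.assoc intro!: nn_integral_cong)
    also have "\<dots> \<le> (\<integral>\<^sup>+ u. (if u = s then 0 else w u * ennreal (pmf (K u) t)) \<partial>count_space UNIV)"
      by (intro nn_integral_mono) (auto intro!: mult_right_mono Suc.IH)
    also have "w s * ennreal (pmf (K s) t) + \<dots> = w t"
      by (subst inv, rule nn_integral_count_space_split_point[symmetric])
    finally show ?case
      by (simp add: add_left_mono)
  qed simp
  have "w s * excursion_measure K s t = (\<Sum>k. w s * taboo K s k t)"
    by (simp add: excursion_measure_def)
  also have "\<dots> \<le> w t"
    by (rule suminf_le_const) (use partial in \<open>auto simp: sum_distrib_left[symmetric]\<close>)
  finally show ?thesis .
qed

text \<open>The difference of \<open>w\<close> and the multiple of the excursion measure is nonnegative and invariant,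
  so its vanishing at a state propagates to all predecessors of that state.\<close>

lemma invariant_measure_eq_excursion_measure:
  assumes inv: "invariant_measure K w"
    and return: "first_return_prob K s sums 1"
    and acc: "accessible K t s"
  shows "w t = w s * excursion_measure K s t"
  using acc unfolding accessible_def
proof (induction rule: converse_rtranclp_induct)
  case base
  then show ?case
    using excursion_measure_return[OF return] by simp
next
  case (step u t)
  define v where "v = (\<lambda>t. w s * excursion_measure K s t)"
  have le: "v r \<le> w r" for r
    unfolding v_def by (rule invariant_measure_ge_excursion_measure[OF inv])
  have fin: "w r < \<infinity>" for r
    using inv unfolding invariant_measure_def by blast
  have fin': "v r < \<infinity>" for r
    using le[of r] fin[of r] by (rule le_less_trans)
  have v: "v r = (\<integral>\<^sup>+ u. v u * ennreal (pmf (K u) r) \<partial>count_space UNIV)" for r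
  proof -
    have "excursion_measure K s r =
        (\<integral>\<^sup>+ u. excursion_measure K s u * ennreal (pmf (K u) r) \<partial>count_space UNIV)"
      by (subst excursion_measure_step, subst (2) nn_integral_count_space_split_point[of _ s])
         (auto simp: excursion_measure_return[OF return] intro!: nn_integral_cong)
    then show ?thesis
      unfolding v_def by (simp add: mult.assoc nn_integral_cmult)
  qed
  have "w t = (\<integral>\<^sup>+ u. w u * ennreal (pmf (K u) t) \<partial>count_space UNIV)"
    using inv unfolding invariant_measure_def by blast
  also have "\<dots> =
      (\<integral>\<^sup>+ u. v u * ennreal (pmf (K u) t) + (w u - v u) * ennreal (pmf (K u) t) \<partial>count_space UNIV)"
    using le by (intro nn_integral_cong) (simp add: distrib_right[symmetric] add_diff_inverse_ennreal)
  also have "\<dots> = v t + (\<integral>\<^sup>+ u. (w u - v u) * ennreal (pmf (K u) t) \<partial>count_space UNIV)"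
    by (subst nn_integral_add) (auto simp: v[symmetric])
  \<comment> \<open>By the induction hypothesis \<open>w t = v t\<close>, and this value is finite,
    so it cancels.\<close>
  finally have "(\<integral>\<^sup>+ u. (w u - v u) * ennreal (pmf (K u) t) \<partial>count_space UNIV) = 0"
    using step.IH fin'[of t] by (auto simp: v_def)
  then have "(w u - v u) * ennreal (pmf (K u) t) = 0"
    by (simp add: nn_integral_0_iff_AE AE_count_space)
  then have "w u - v u = 0"
    using step.hyps(1) by (simp add: set_pmf_iff pmf_nonneg less_le)
  then show ?case
    using le[of u] fin[of u] by (simp add: v_def diff_eq_0_iff_ennreal)
qed

section \<open>Positive recurrence and finite total mass\<close>

lemma positive_recurrent_stateI:
  assumes "invariant_measure K w" "w s > 0" "total_mass w < \<infinity>"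
  shows "positive_recurrent_state K s"
proof -
  have "w s * (\<Sum>n. ennreal (survival K s n)) = (\<integral>\<^sup>+ t. w s * excursion_measure K s t \<partial>count_space UNIV)"
    by (simp add: total_mass_excursion_measure[symmetric] total_mass_def nn_integral_cmult)
  \<comment> \<open>The pointwise domination by \<open>w\<close> is integrated over all
    states.\<close>
  also have "\<dots> \<le> total_mass w"
    unfolding total_mass_def
    by (intro nn_integral_mono invariant_measure_ge_excursion_measure assms)
  finally have "w s * (\<Sum>n. ennreal (survival K s n)) < \<infinity>"
    using assms(3) by (rule le_less_trans)
  then show ?thesis
    unfolding positive_recurrent_state_iff
    using assms(2) by (auto simp: ennreal_mult_less_top top.not_eq_extremum)
qed

lemma total_mass_finite_if_positive_recurrent_state:
  assumes inv: "invariant_measure K w" and rec: "positive_recurrent_state K s"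
    and acc: "\<And>t. accessible K t s"
  shows "total_mass w < \<infinity>"
proof -
  have "w = (\<lambda>t. w s * excursion_measure K s t)"
    using invariant_measure_eq_excursion_measure[OF inv _ acc] rec
    unfolding positive_recurrent_state_def by blast
  then have "total_mass w = total_mass (\<lambda>t. w s * excursion_measure K s t)"
    by (rule arg_cong)
  also have "\<dots> = w s * (\<Sum>n. ennreal (survival K s n))"
    by (simp add: total_mass_excursion_measure[symmetric] total_mass_def nn_integral_cmult)
  also have "\<dots> < \<infinity>"
  proof -
    have "w s < \<infinity>"
      using inv unfolding invariant_measure_def by blast
    then show ?thesis
      using rec by (simp add: ennreal_mult_less_top positive_recurrent_state_iff)
  qed
  finally show ?thesis .
qed

text \<open>Every closed class contains a state accessible from everywhere. So there is exactly one
  closed class, namely all that is accessible from \<open>s\<close>.\<close>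

lemma positive_recurrent_chain_iff:
  assumes acc: "\<And>t. accessible K t s"
  shows "positive_recurrent_chain K \<longleftrightarrow> (\<forall>t. accessible K s t \<longrightarrow> positive_recurrent_state K t)"
proof -
  have acc_trans: "accessible K a c" if "accessible K a b" "accessible K b c" for a b c
    using that unfolding accessible_def by simp
  have "closed_communicating_class K {t. accessible K s t}"
    unfolding closed_communicating_class_def communicating_class_def
    using acc acc_trans by (auto intro!: exI[of _ s])
  moreover have "D = {t. accessible K s t}" if D: "closed_communicating_class K D" for D
  proof -
    obtain r where r: "D = {t. accessible K r t \<and> accessible K t r}"
      and closed: "\<And>u t. u \<in> D \<Longrightarrow> accessible K u t \<Longrightarrow> t \<in> D"
      using D unfolding closed_communicating_class_def communicating_class_def by blast
    have "r \<in> D"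
      unfolding r by (simp add: accessible_def)
    then have "s \<in> D"
      using closed acc by blast
    then show ?thesis
      using r closed acc_trans[of s r] by blast
  qed
  ultimately have *: "closed_communicating_class K D \<longleftrightarrow> D = {t. accessible K s t}" for D
    by blast
  show ?thesis
    unfolding positive_recurrent_chain_def * by auto
qed

lemma invariant_measure_pos_of_accessible:
  assumes inv: "invariant_measure K w" and "accessible K s t" "w s > 0"
  shows "w t > 0"
  using assms(2) unfolding accessible_def
proof (induction rule: rtranclp_induct)
  case (step u t)
  have "0 < w u * ennreal (pmf (K u) t)"
    using step by (simp add: ennreal_zero_less_mult_iff pmf_positive)
  also have "\<dots> \<le> (\<integral>\<^sup>+ u. w u * ennreal (pmf (K u) t) \<partial>count_space UNIV)"
    by (rule nn_integral_ge_point) simp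
  also have "\<dots> = w t"
    using inv unfolding invariant_measure_def by metis
  finally show ?case .
qed (use assms in simp)

lemma positive_recurrent_chain_iff_total_mass:
  assumes inv: "invariant_measure K w" and acc: "\<And>t. accessible K t s"
  shows "positive_recurrent_chain K \<longleftrightarrow> total_mass w < \<infinity>"
proof
  assume "positive_recurrent_chain K"
  then have "positive_recurrent_state K s"
    using acc by (simp add: positive_recurrent_chain_iff[OF acc])
  then show "total_mass w < \<infinity>"
    by (rule total_mass_finite_if_positive_recurrent_state[OF inv _ acc])
next
  assume fin: "total_mass w < \<infinity>"
  \<comment> \<open>Positive mass at some \<open>r\<close> flows to \<open>s\<close> and from there
    to the whole closed class.\<close>
  obtain r where "w r > 0"
    using inv unfolding invariant_measure_def zero_less_iff_neq_zero by blast
  then have "w s > 0"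
    using invariant_measure_pos_of_accessible[OF inv acc] by blast
  then show "positive_recurrent_chain K"
    unfolding positive_recurrent_chain_iff[OF acc]
    using positive_recurrent_stateI[OF inv _ fin] invariant_measure_pos_of_accessible[OF inv] by blast
qed

section \<open>Predecessors in the juggling chain\<close>

lemma part_antimono: "i \<le> j \<Longrightarrow> part l j \<le> part l i"
  using part[of l] by (auto dest: antimonoD)

lemma part_eventually_0: obtains N where "\<And>k. k \<ge> N \<Longrightarrow> part l k = 0"
  using part[of l] by (auto simp: eventually_sequentially)

lift_definition empty_par :: par is "\<lambda>_. 0"
  by (simp add: antimono_def)

lift_definition drop_par :: "nat \<Rightarrow> par \<Rightarrow> par" is "\<lambda>n l k. l (n + k)"
  by (auto simp: antimono_def eventually_sequentially) (meson le_add2 le_trans)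

text \<open>The predecessor of \<open>l\<close> in which the throw landed at position \<open>j\<close>.\<close>

lift_definition unthrow :: "nat \<Rightarrow> par \<Rightarrow> par" is
  "\<lambda>j l k. if k < j then Suc (l k) else l (Suc k)"
proof -
  fix j :: nat and l :: "nat \<Rightarrow> nat"
  assume l: "antimono l \<and> (\<forall>\<^sub>F j in sequentially. l j = 0)"
  then obtain N where N: "\<And>k. k \<ge> N \<Longrightarrow> l k = 0"
    by (auto simp: eventually_sequentially)
  have mono: "l b \<le> l a" if "a \<le> b" for a b
    using l that by (auto dest: antimonoD)
  have "antimono (\<lambda>k. if k < j then Suc (l k) else l (Suc k))"
    by (rule antimonoI) (auto intro: mono le_SucI)
  moreover have "(if k < j then Suc (l k) else l (Suc k)) = 0" if "k \<ge> max N j" for k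
    using that N by simp
  ultimately show "antimono (\<lambda>k. if k < j then Suc (l k) else l (Suc k)) \<and>
      (\<forall>\<^sub>F k in sequentially. (if k < j then Suc (l k) else l (Suc k)) = 0)"
    unfolding eventually_sequentially by blast
qed

text \<open>The maximum only serves to make the operation total; it is used for \<open>m \<ge> part l 0\<close>.\<close>

lift_definition prepend :: "nat \<Rightarrow> nat \<Rightarrow> par \<Rightarrow> par" is
  "\<lambda>n m l k. if k < n then max m (l 0) else l (k - n)"
proof -
  fix n m :: nat and l :: "nat \<Rightarrow> nat"
  assume l: "antimono l \<and> (\<forall>\<^sub>F j in sequentially. l j = 0)"
  then obtain N where N: "\<And>k. k \<ge> N \<Longrightarrow> l k = 0"
    by (auto simp: eventually_sequentially)
  have mono: "l b \<le> l a" if "a \<le> b" for a b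
    using l that by (auto dest: antimonoD)
  have "antimono (\<lambda>k. if k < n then max m (l 0) else l (k - n))"
    by (rule antimonoI) (auto intro: mono le_max_iff_disj[THEN iffD2])
  moreover have "(if k < n then max m (l 0) else l (k - n)) = 0" if "k \<ge> N + n" for k
    using that N by simp
  ultimately show "antimono (\<lambda>k. if k < n then max m (l 0) else l (k - n)) \<and>
      (\<forall>\<^sub>F k in sequentially. (if k < n then max m (l 0) else l (k - n)) = 0)"
    unfolding eventually_sequentially by blast
qed

lemma par_eqI: "(\<And>k. part l k = part m k) \<Longrightarrow> l = m"
  by (metis part_inject ext)

lemma par_eq_empty_par: "part l 0 = 0 \<Longrightarrow> l = empty_par"
  using part_antimono[of 0 _ l] by (intro par_eqI) (simp add: empty_par.rep_eq)

text \<open>The raised parts before \<open>j\<close> exceed \<open>part l j\<close>, while the part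
  that moves into position \<open>j\<close> is at most \<open>part l j\<close>; so the throw lands
  exactly at \<open>j\<close>.\<close>

lemma throw_unthrow: "throw (part l j) (unthrow j l) = l"
proof -
  have j: "j = (LEAST k. part (unthrow j l) k \<le> part l j)"
  proof (rule Least_equality[symmetric])
    show "part (unthrow j l) j \<le> part l j"
      by (simp add: unthrow.rep_eq part_antimono)
    show "j \<le> k" if "part (unthrow j l) k \<le> part l j" for k
    proof (rule ccontr)
      assume "\<not> j \<le> k"
      then show False
        using that part_antimono[of k j l] by (simp add: unthrow.rep_eq)
    qed
  qed
  show ?thesis
    by (rule par_eqI) (auto simp: part_throw[OF j] unthrow.rep_eq)
qed

text \<open>The witness is the landing position. The parts before it exceed \<open>i\<close>, hence
  are positive, so the truncated subtraction in \<open>throw\<close> is undone by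
  \<open>Suc\<close>.\<close>

lemma unthrow_throw: "\<exists>j. part (throw i l) j = i \<and> unthrow j (throw i l) = l"
proof -
  define j where "j = (LEAST j. part l j \<le> i)"
  have gt: "part l k > i" if "k < j" for k
    using not_less_Least[of k "\<lambda>j. part l j \<le> i"] that by (simp add: j_def)
  have "part (throw i l) j = i"
    by (simp add: part_throw[OF j_def])
  moreover have "unthrow j (throw i l) = l"
    using gt by (intro par_eqI) (auto simp: part_throw[OF j_def] unthrow.rep_eq gr_implies_not0 dest!: gt)
  ultimately show ?thesis by blast
qed

text \<open>For \<open>i < j\<close> the results differ at position \<open>i\<close>: one has
  \<open>part l (Suc i)\<close> there, the other \<open>Suc (part l i)\<close>. Even trailing zeros
  yield distinct predecessors, so the balance equation is an infinite series over
  \<open>j\<close>.\<close>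

lemma inj_unthrow: "inj (\<lambda>j. unthrow j l)"
proof -
  have "unthrow i l \<noteq> unthrow j l" if "i < j" for i j
  proof
    assume "unthrow i l = unthrow j l"
    then have "part (unthrow i l) i = part (unthrow j l) i" by simp
    then show False
      using that part_antimono[of i "Suc i" l] by (simp add: unthrow.rep_eq)
  qed
  then show ?thesis
    by (metis injI linorder_neqE_nat)
qed

text \<open>A throw at height 0 lands behind all positive parts and lowers each of them by one,
  whence induction on the largest part.\<close>

lemma accessible_empty_par:
  assumes nonneg: "\<And>i. x i \<ge> 0" and "x sums 1" and "x 0 > 0"
  shows "accessible (imjmc x) l empty_par"
proof (induction "part l 0" arbitrary: l)
  case 0
  then show ?case
    using par_eq_empty_par[of l] by (simp add: accessible_def)
next
  case (Suc n)
  have pos: "0 < (LEAST j. part l j \<le> 0)"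
  proof (rule ccontr)
    obtain N where "part l N \<le> 0"
      using part_eventually_0[of l] by (metis order_refl)
    then have "part l (LEAST j. part l j \<le> 0) \<le> 0"
      by (rule LeastI)
    moreover assume "\<not> 0 < (LEAST j. part l j \<le> 0)"
    ultimately show False
      using Suc.hyps(2) by simp
  qed
  have "n = part (throw 0 l) 0"
    using Suc.hyps(2) pos by (simp add: part_throw[OF refl])
  then have "accessible (imjmc x) (throw 0 l) empty_par"
    by (rule Suc.hyps(1))
  moreover have "throw 0 l \<in> set_pmf (imjmc x l)"
    using assms by (simp add: set_pmf_iff pmf_imjmc imjmc_matrix_throw)
  ultimately show ?case
    unfolding accessible_def by (rule converse_rtranclp_into_rtranclp[rotated])
qed

section \<open>The juggling weight\<close>

context
  fixes x :: "nat \<Rightarrow> real"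
  assumes nonneg: "\<And>i. x i \<ge> 0" and sums: "x sums 1" and pos: "x 0 > 0"
begin

section \<open>Tail sums and elementary properties of the weight\<close>

lemma summable_shift: "summable (\<lambda>j. x (m + j))"
  using sums summable_iff_shift[of x m] by (auto simp: sums_iff add.commute)

lemma tail_sum_nonneg: "tail_sum x m \<ge> 0"
  unfolding tail_sum_def by (intro suminf_nonneg summable_shift nonneg)

lemma tail_sum_0: "tail_sum x 0 = 1"
  using sums by (simp add: tail_sum_def sums_iff)

lemma tail_sum_Suc: "tail_sum x m = x m + tail_sum x (Suc m)"
  using suminf_split_head[OF summable_shift[of m]] by (simp add: tail_sum_def)

lemma tail_sum_antimono: "m \<le> n \<Longrightarrow> tail_sum x n \<le> tail_sum x m"
proof (rule lift_Suc_antimono_le)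
  show "tail_sum x (Suc k) \<le> tail_sum x k" for k
    using tail_sum_Suc[of k] nonneg[of k] by simp
qed

text \<open>This bound away from 1 is uniform in \<open>m\<close>; it supplies the constant
  \<open>x 0\<close> in the estimate of the total mass.\<close>

lemma tail_sum_Suc_le: "tail_sum x (Suc m) \<le> 1 - x 0"
  using tail_sum_antimono[of 1 "Suc m"] tail_sum_Suc[of 0] by (simp add: tail_sum_0)

lemma tail_sum_less_1: "tail_sum x (Suc m) < 1"
  using tail_sum_Suc_le[of m] pos by simp

lemma juggling_weight_finite:
  assumes "\<And>k. k \<ge> N \<Longrightarrow> part l k = 0"
  shows "juggling_weight x l = (\<Prod>k<N. tail_sum x (part l k))"
  unfolding juggling_weight_def
  by (rule has_prod_unique[symmetric], rule has_prod_finite) (auto simp: assms tail_sum_0)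

lemma juggling_weight_nonneg: "juggling_weight x l \<ge> 0"
proof -
  obtain N where "\<And>k. k \<ge> N \<Longrightarrow> part l k = 0"
    using part_eventually_0[of l] by blast
  then show ?thesis
    by (subst juggling_weight_finite) (auto intro: prod_nonneg tail_sum_nonneg)
qed

lemma juggling_weight_empty_par: "juggling_weight x empty_par = 1"
  by (subst juggling_weight_finite[of 0]) (auto simp: empty_par.rep_eq)

section \<open>The balance equation\<close>

lemma juggling_weight_drop:
  "juggling_weight x l = (\<Prod>k<n. tail_sum x (part l k)) * juggling_weight x (drop_par n l)"
proof -
  obtain N where N: "\<And>k. k \<ge> N \<Longrightarrow> part l k = 0"
    using part_eventually_0[of l] by blast
  have "juggling_weight x l = (\<Prod>k<n + N. tail_sum x (part l k))"
    by (rule juggling_weight_finite) (simp add: N)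
  moreover have "juggling_weight x (drop_par n l) = (\<Prod>k<N. tail_sum x (part l (n + k)))"
    by (subst juggling_weight_finite[of N]) (auto simp: N drop_par.rep_eq)
  moreover have "(\<Prod>k<n + N. tail_sum x (part l k)) =
      (\<Prod>k<n. tail_sum x (part l k)) * (\<Prod>k<N. tail_sum x (part l (n + k)))"
    by (induction N) simp_all
  ultimately show ?thesis by simp
qed

lemma juggling_weight_unthrow_sums:
  "(\<lambda>j. juggling_weight x (unthrow j l) * x (part l j)) sums juggling_weight x l"
proof -
  \<comment> \<open>\<open>T j\<close> is the weight after the first \<open>j\<close> parts have
    been raised by one. Passing to \<open>Suc j\<close> replaces the factor
    \<open>tail_sum x (part l j)\<close> by its successor, and the two differ by
    \<open>x (part l j)\<close>.\<close>
  define T where "T j = (\<Prod>k<j. tail_sum x (Suc (part l k))) * juggling_weight x (drop_par j l)" for j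
  have step: "juggling_weight x (unthrow j l) * x (part l j) = T j - T (Suc j)" for j
  proof -
    have "drop_par j (unthrow j l) = drop_par (Suc j) l"
      by (rule par_eqI) (simp add: drop_par.rep_eq unthrow.rep_eq)
    then have "juggling_weight x (unthrow j l) =
        (\<Prod>k<j. tail_sum x (Suc (part l k))) * juggling_weight x (drop_par (Suc j) l)"
      by (subst juggling_weight_drop[of _ j]) (simp add: unthrow.rep_eq)
    moreover have "drop_par 1 (drop_par j l) = drop_par (Suc j) l"
      by (rule par_eqI) (simp add: drop_par.rep_eq)
    then have "juggling_weight x (drop_par j l) = tail_sum x (part l j) * juggling_weight x (drop_par (Suc j) l)"
      by (subst juggling_weight_drop[of _ 1]) (simp add: drop_par.rep_eq)
    ultimately show ?thesis
      using tail_sum_Suc[of "part l j"] by (simp add: T_def algebra_simps)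
  qed
  obtain N where N: "\<And>k. k \<ge> N \<Longrightarrow> part l k = 0"
    using part_eventually_0[of l] by blast
  \<comment> \<open>Beyond \<open>N\<close> only zeros are raised, each contributing a factor
    \<open>tail_sum x 1 < 1\<close>; this makes \<open>T\<close> vanish in the limit.\<close>
  have "T (j + N) = T N * tail_sum x 1 ^ j" for j
  proof -
    have "drop_par (i + N) l = empty_par" for i
      by (rule par_eqI) (simp add: drop_par.rep_eq empty_par.rep_eq N)
    from this[of j] this[of 0]
    have "T (j + N) = (\<Prod>k<j + N. tail_sum x (Suc (part l k)))" "T N = (\<Prod>k<N. tail_sum x (Suc (part l k)))"
      by (simp_all add: T_def juggling_weight_empty_par)
    moreover have "(\<Prod>k<j + N. tail_sum x (Suc (part l k))) =
        (\<Prod>k<N. tail_sum x (Suc (part l k))) * tail_sum x 1 ^ j"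
      by (induction j) (simp_all add: N)
    ultimately show ?thesis by simp
  qed
  moreover have "(\<lambda>j. T N * tail_sum x 1 ^ j) \<longlonglongrightarrow> 0"
    using tail_sum_Suc_le[of 0] tail_sum_nonneg[of 1] pos
    by (intro tendsto_mult_right_zero LIMSEQ_realpow_zero) auto
  ultimately have "T \<longlonglongrightarrow> 0"
    by (intro LIMSEQ_offset[of T N]) simp
  then have "(\<lambda>j. T j - T (Suc j)) sums (T 0 - 0)"
    by (rule telescope_sums')
  moreover have "drop_par 0 l = l"
    by (rule par_eqI) (simp add: drop_par.rep_eq)
  ultimately show ?thesis
    by (simp add: step T_def)
qed

lemma invariant_measure_juggling_weight:
  "invariant_measure (imjmc x) (\<lambda>l. ennreal (juggling_weight x l))"
  unfolding invariant_measure_def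
proof (intro conjI allI)
  show "\<exists>l. ennreal (juggling_weight x l) \<noteq> 0"
    by (rule exI[of _ empty_par]) (simp add: juggling_weight_empty_par)
  fix l
  show "ennreal (juggling_weight x l) < \<infinity>"
    by simp
  have pmf: "pmf (imjmc x (unthrow j l)) l = x (part l j)" for j
    using imjmc_matrix_throw[of x "unthrow j l" "part l j"]
    by (simp add: pmf_imjmc[OF nonneg sums] throw_unthrow)
  have zero: "pmf (imjmc x m) l = 0" if "m \<notin> range (\<lambda>j. unthrow j l)" for m
  proof -
    have "l \<noteq> throw i m" for i
    proof
      assume "l = throw i m"
      then obtain j where "unthrow j l = m"
        using unthrow_throw[of i m] by blast
      then show False
        using that by blast
    qed
    then show ?thesis
      by (simp add: pmf_imjmc[OF nonneg sums] imjmc_matrix_def)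
  qed
  \<comment> \<open>Only predecessors of \<open>l\<close> contribute, and these are indexed
    injectively by the landing position.\<close>
  have "(\<integral>\<^sup>+ m. ennreal (juggling_weight x m) * ennreal (pmf (imjmc x m) l) \<partial>count_space UNIV) =
      (\<integral>\<^sup>+ m. ennreal (juggling_weight x m) * ennreal (pmf (imjmc x m) l)
          \<partial>count_space (range (\<lambda>j. unthrow j l)))"
    by (rule nn_integral_count_space_eq) (auto simp: zero)
  also have "\<dots> =
      (\<integral>\<^sup>+ j. ennreal (juggling_weight x (unthrow j l)) * ennreal (pmf (imjmc x (unthrow j l)) l) \<partial>count_space UNIV)"
    by (rule nn_integral_bij_count_space[symmetric]) (simp add: bij_betw_def inj_unthrow)
  also have "\<dots> = (\<Sum>j. ennreal (juggling_weight x (unthrow j l) * x (part l j)))"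
    by (simp add: nn_integral_count_space_nat pmf ennreal_mult juggling_weight_nonneg nonneg)
  also have "\<dots> = ennreal (juggling_weight x l)"
    by (rule suminf_ennreal_eq[OF _ juggling_weight_unthrow_sums])
       (simp add: juggling_weight_nonneg nonneg)
  finally show "ennreal (juggling_weight x l) =
      (\<integral>\<^sup>+ m. ennreal (juggling_weight x m) * ennreal (pmf (imjmc x m) l) \<partial>count_space UNIV)" ..
qed

section \<open>The total mass as an infinite product\<close>

lemma bij_betw_prepend:
  "bij_betw (\<lambda>(k, l). prepend k (Suc n) l) (UNIV \<times> {l. part l 0 \<le> n}) {l. part l 0 \<le> Suc n}"
proof (rule bij_betwI')
  show "((\<lambda>(k, l). prepend k (Suc n) l) p = (\<lambda>(k, l). prepend k (Suc n) l) q) = (p = q)"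
    if p: "p \<in> UNIV \<times> {l. part l 0 \<le> n}" and q: "q \<in> UNIV \<times> {l. part l 0 \<le> n}" for p q
  proof -
    \<comment> \<open>The multiplicity \<open>k\<close> of the part \<open>Suc n\<close> is
      recovered as the first index whose part is at most \<open>n\<close>; dropping \<open>k\<close>
      parts then recovers \<open>l\<close>.\<close>
    have least: "k = (LEAST j. part (prepend k (Suc n) l) j \<le> n)" if "part l 0 \<le> n" for k l
      using that by (intro Least_equality[symmetric]) (auto simp: prepend.rep_eq split: if_splits)
    have drop: "l = drop_par k (prepend k (Suc n) l)" for k l
      by (rule par_eqI) (simp add: drop_par.rep_eq prepend.rep_eq)
    obtain k l k' l' where *: "p = (k, l)" "q = (k', l')"
      by (cases p, cases q)
    have "k = k' \<and> l = l'" if "prepend k (Suc n) l = prepend k' (Suc n) l'"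
    proof
      show "k = k'"
        using least[of l k] least[of l' k'] p q that by (simp add: *)
      then show "l = l'"
        using drop[of l k] drop[of l' k'] that by simp
    qed
    then show ?thesis by (auto simp: *)
  qed
  show "(\<lambda>(k, l). prepend k (Suc n) l) p \<in> {l. part l 0 \<le> Suc n}"
    if "p \<in> UNIV \<times> {l. part l 0 \<le> n}" for p
    using that by (auto simp: prepend.rep_eq)
  show "\<exists>p\<in>UNIV \<times> {l. part l 0 \<le> n}. l = (\<lambda>(k, l). prepend k (Suc n) l) p"
    if "l \<in> {l. part l 0 \<le> Suc n}" for l
  proof -
    define k where "k = (LEAST j. part l j \<le> n)"
    obtain N where "part l N \<le> n"
      using part_eventually_0[of l] by (metis order_refl le0)
    then have k: "part l k \<le> n"
      unfolding k_def by (rule LeastI)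
    have "part l i = Suc n" if "i < k" for i
      using not_less_Least[of i "\<lambda>j. part l j \<le> n"] that part_antimono[of 0 i l] \<open>l \<in> _\<close>
      by (auto simp: k_def)
    then have "l = prepend k (Suc n) (drop_par k l)"
      using k by (intro par_eqI) (auto simp: prepend.rep_eq drop_par.rep_eq)
    with k show ?thesis
      by (intro bexI[of _ "(k, drop_par k l)"]) (auto simp: drop_par.rep_eq)
  qed
qed

lemma juggling_weight_prepend:
  assumes "part l 0 \<le> m"
  shows "juggling_weight x (prepend k m l) = tail_sum x m ^ k * juggling_weight x l"
proof -
  have "drop_par k (prepend k m l) = l"
    by (rule par_eqI) (simp add: drop_par.rep_eq prepend.rep_eq)
  then show ?thesis
    using assms by (subst juggling_weight_drop[of _ k]) (simp add: prepend.rep_eq max_absorb1)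
qed

text \<open>Allowing one more part size multiplies the mass by the geometric series over the
  multiplicity of that size.\<close>

lemma nn_integral_juggling_weight_bounded:
  "(\<integral>\<^sup>+ l. ennreal (juggling_weight x l) \<partial>count_space {l. part l 0 \<le> n}) =
    ennreal (\<Prod>m<n. 1 / (1 - tail_sum x (Suc m)))"
proof (induction n)
  case 0
  have "{l. part l 0 \<le> 0} = {empty_par}"
    using par_eq_empty_par by (auto simp: empty_par.rep_eq)
  then show ?case
    by (simp add: nn_integral_count_space_finite juggling_weight_empty_par)
next
  case (Suc n)
  let ?y = "tail_sum x (Suc n)" and ?S = "{l. part l 0 \<le> n}"
  have y: "0 \<le> ?y" "?y < 1" "norm ?y < 1"
    using tail_sum_nonneg[of "Suc n"] tail_sum_Suc_le[of n] pos by auto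
  have "(\<integral>\<^sup>+ l. ennreal (juggling_weight x l) \<partial>count_space {l. part l 0 \<le> Suc n}) =
      (\<integral>\<^sup>+ p. ennreal (juggling_weight x (case p of (k, l) \<Rightarrow> prepend k (Suc n) l))
          \<partial>count_space (UNIV \<times> ?S))"
    by (rule nn_integral_bij_count_space[OF bij_betw_prepend, symmetric])
  also have "\<dots> =
      (\<integral>\<^sup>+ p. (case p of (k, l) \<Rightarrow> ennreal (?y ^ k) * ennreal (juggling_weight x l) * indicator ?S l) \<partial>count_space UNIV)"
    by (subst nn_integral_count_space_indicator, simp)
       (auto simp: juggling_weight_prepend ennreal_mult y juggling_weight_nonneg indicator_def intro!: nn_integral_cong)
  also have "\<dots> =
      (\<integral>\<^sup>+ k. \<integral>\<^sup>+ l. ennreal (?y ^ k) * ennreal (juggling_weight x l) * indicator ?S l \<partial>count_space UNIV \<partial>count_space UNIV)"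
    by (subst nn_integral_fst_count_space[symmetric]) simp
  also have "\<dots> =
      (\<integral>\<^sup>+ k. ennreal (?y ^ k) * (\<integral>\<^sup>+ l. ennreal (juggling_weight x l) \<partial>count_space ?S) \<partial>count_space UNIV)"
    by (simp add: nn_integral_cmult nn_integral_count_space_indicator mult.assoc)
  also have "\<dots> = (\<Sum>k. ennreal (?y ^ k)) * (\<integral>\<^sup>+ l. ennreal (juggling_weight x l) \<partial>count_space ?S)"
    by (simp add: nn_integral_multc nn_integral_count_space_nat)
  also have "(\<Sum>k. ennreal (?y ^ k)) = ennreal (1 / (1 - ?y))"
    using y geometric_sums[of ?y] by (intro suminf_ennreal_eq) auto
  finally show ?case
    using y by (simp add: Suc.IH ennreal_mult[symmetric] prod_nonneg mult.commute
        tail_sum_less_1 less_imp_le)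
qed

text \<open>Monotone convergence: the sets of partitions with largest part at most \<open>n\<close>
  exhaust all partitions.\<close>

lemma total_mass_juggling_weight_tendsto:
  "(\<lambda>n. ennreal (\<Prod>m<n. 1 / (1 - tail_sum x (Suc m)))) \<longlonglongrightarrow>
     total_mass (\<lambda>l. ennreal (juggling_weight x l))"
proof -
  let ?f = "\<lambda>n l. ennreal (juggling_weight x l) * indicator {l. part l 0 \<le> n} l"
  have inc: "incseq ?f"
    by (intro incseq_SucI le_funI) (auto simp: indicator_def)
  have lim: "(\<lambda>n. ?f n l) \<longlonglongrightarrow> ennreal (juggling_weight x l)" for l
    by (rule tendsto_eventually) (auto simp: eventually_sequentially intro!: exI[of _ "part l 0"])
  have "total_mass (\<lambda>l. ennreal (juggling_weight x l)) = (\<integral>\<^sup>+ l. (SUP n. ?f n l) \<partial>count_space UNIV)"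
    unfolding total_mass_def
    by (intro nn_integral_cong LIMSEQ_unique[OF lim LIMSEQ_SUP])
       (use inc in \<open>auto simp: incseq_def le_fun_def\<close>)
  also have "\<dots> = (SUP n. \<integral>\<^sup>+ l. ?f n l \<partial>count_space UNIV)"
    by (rule nn_integral_monotone_convergence_SUP[OF inc]) simp
  finally have "total_mass (\<lambda>l. ennreal (juggling_weight x l)) = (SUP n. \<integral>\<^sup>+ l. ?f n l
      \<partial>count_space UNIV)" .
  moreover have "(\<lambda>n. \<integral>\<^sup>+ l. ?f n l \<partial>count_space UNIV) \<longlonglongrightarrow> (SUP n. \<integral>\<^sup>+ l. ?f n l \<partial>count_space UNIV)"
    by (rule LIMSEQ_SUP) (use inc in \<open>auto simp: incseq_def le_fun_def intro!: nn_integral_mono\<close>)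
  ultimately show ?thesis
    by (simp add: nn_integral_juggling_weight_bounded[symmetric] nn_integral_count_space_indicator)
qed

lemma partial_product_ge_1: "1 \<le> (\<Prod>m<n. 1 / (1 - tail_sum x (Suc m)))"
  using tail_sum_Suc_le tail_sum_nonneg pos by (intro prod_ge_1) (smt (verit) le_divide_eq_1)

lemma total_mass_juggling_weight:
  "total_mass (\<lambda>l. ennreal (juggling_weight x l)) = (\<Prod>m. ennreal (1 / (1 - tail_sum x (Suc m))))"
proof -
  let ?Z = "total_mass (\<lambda>l. ennreal (juggling_weight x l))"
  have "(\<lambda>n. \<Prod>m<n. ennreal (1 / (1 - tail_sum x (Suc m)))) \<longlonglongrightarrow> ?Z"
    using total_mass_juggling_weight_tendsto tail_sum_less_1 by (simp add: prod_ennreal less_imp_le)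
  then have "(\<lambda>n. \<Prod>m\<le>n. ennreal (1 / (1 - tail_sum x (Suc m)))) \<longlonglongrightarrow> ?Z"
    by (subst (asm) LIMSEQ_lessThan_iff_atMost)
  moreover have "1 \<le> ?Z"
    by (rule LIMSEQ_le_const[OF total_mass_juggling_weight_tendsto])
       (use partial_product_ge_1 in auto)
  \<comment> \<open>An infinite product in the sense of \<open>has_prod\<close> must have a nonzero
    limit here; the value infinity is admissible in \<open>ennreal\<close>.\<close>
  then have "?Z \<noteq> 0" by auto
  moreover have "ennreal (1 / (1 - tail_sum x (Suc m))) \<noteq> 0" for m
    using tail_sum_less_1[of m] by (simp add: ennreal_eq_0_iff not_le)
  ultimately show ?thesis
    by (rule prodinf_ennreal_eqI[symmetric])
qed

section \<open>Finiteness of the total mass\<close>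

lemma total_mass_juggling_weight_finite_iff:
  "total_mass (\<lambda>l. ennreal (juggling_weight x l)) < \<infinity> \<longleftrightarrow> summable (\<lambda>m. tail_sum x (Suc m))"
proof
  let ?Z = "total_mass (\<lambda>l. ennreal (juggling_weight x l))"
  assume fin: "?Z < \<infinity>"
  have mono: "incseq (\<lambda>n. ennreal (\<Prod>m<n. 1 / (1 - tail_sum x (Suc m))))"
    unfolding nn_integral_juggling_weight_bounded[symmetric]
    by (rule incseq_SucI) (auto simp: nn_integral_count_space_indicator indicator_def intro!: nn_integral_mono)
  show "summable (\<lambda>m. tail_sum x (Suc m))"
  proof (rule bounded_imp_summable)
    fix n
    \<comment> \<open>Expanding the product of the factors \<open>1 + tail_sum x (Suc m)\<close>
      yields every summand on the left.\<close>
    have "(\<Sum>m\<le>n. tail_sum x (Suc m)) \<le> (\<Prod>m<Suc n. 1 + tail_sum x (Suc m))"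
      by (simp only: lessThan_Suc_atMost) (rule sum_le_prod, rule tail_sum_nonneg)
    also have "\<dots> \<le> (\<Prod>m<Suc n. 1 / (1 - tail_sum x (Suc m)))"
    proof (rule prod_mono, rule conjI)
      fix m
      have "1 - tail_sum x (Suc m) > 0"
        using tail_sum_Suc_le[of m] pos by simp
      then show "1 + tail_sum x (Suc m) \<le> 1 / (1 - tail_sum x (Suc m))"
        by (simp add: le_divide_eq algebra_simps)
    qed (simp add: tail_sum_nonneg)
    also have "ennreal (\<Prod>m<Suc n. 1 / (1 - tail_sum x (Suc m))) \<le> ?Z"
      by (rule incseq_le[OF mono total_mass_juggling_weight_tendsto])
    then have "(\<Prod>m<Suc n. 1 / (1 - tail_sum x (Suc m))) \<le> enn2real ?Z"
      using fin by (cases ?Z) auto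
    finally show "(\<Sum>m\<le>n. tail_sum x (Suc m)) \<le> enn2real ?Z" .
  qed (rule tail_sum_nonneg)
next
  let ?Z = "total_mass (\<lambda>l. ennreal (juggling_weight x l))"
  assume sum: "summable (\<lambda>m. tail_sum x (Suc m))"
  \<comment> \<open>\<open>B\<close> is the limit of the products of the factor bounds
    \<open>exp (tail_sum x (Suc m) / x 0)\<close>.\<close>
  define B where "B = exp ((\<Sum>m. tail_sum x (Suc m)) / x 0)"
  have "(\<Prod>m<n. 1 / (1 - tail_sum x (Suc m))) \<le> B" for n
  proof -
    have "(\<Prod>m<n. 1 / (1 - tail_sum x (Suc m))) \<le> (\<Prod>m<n. exp (tail_sum x (Suc m) / x 0))"
    proof (rule prod_mono, rule conjI)
      fix m
      let ?y = "tail_sum x (Suc m)"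
      have y: "0 \<le> ?y" "x 0 \<le> 1 - ?y"
        using tail_sum_nonneg[of "Suc m"] tail_sum_Suc_le[of m] by auto
      then have "1 / (1 - ?y) = 1 + ?y / (1 - ?y)"
        using pos by (simp add: field_simps)
      also have "\<dots> \<le> 1 + ?y / x 0"
        using y pos by (intro add_left_mono divide_left_mono) auto
      also have "\<dots> \<le> exp (?y / x 0)"
        by (rule exp_ge_add_one_self)
      finally show "1 / (1 - ?y) \<le> exp (?y / x 0)" .
      show "0 \<le> 1 / (1 - ?y)"
        using y pos by simp
    qed
    also have "\<dots> = exp ((\<Sum>m<n. tail_sum x (Suc m)) / x 0)"
      by (simp add: exp_sum sum_divide_distrib)
    also have "\<dots> \<le> B"
      using pos sum unfolding B_def
      by (simp add: divide_right_mono sum_le_suminf tail_sum_nonneg)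
    finally show ?thesis .
  qed
  then have "?Z \<le> ennreal B"
    by (intro LIMSEQ_le_const2[OF total_mass_juggling_weight_tendsto]) (auto intro!: ennreal_leI)
  then show "?Z < \<infinity>"
    by (rule le_less_trans) simp
qed

lemma summable_tail_sum_iff:
  "summable (\<lambda>m. tail_sum x (Suc m)) \<longleftrightarrow> summable (\<lambda>i. real i * x i)"
proof -
  have "(\<Sum>m. ennreal (tail_sum x (Suc m))) = (\<Sum>i. ennreal (real i * x i))"
    unfolding tail_sum_def by (rule suminf_tail_sums[OF nonneg sums_summable[OF sums]])
  moreover have "summable (\<lambda>m. tail_sum x (Suc m)) \<longleftrightarrow> (\<Sum>m. ennreal (tail_sum x (Suc m))) < \<infinity>"
    by (rule summable_iff_suminf_ennreal[OF tail_sum_nonneg])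
  moreover have "summable (\<lambda>i. real i * x i) \<longleftrightarrow> (\<Sum>i. ennreal (real i * x i)) < \<infinity>"
    by (rule summable_iff_suminf_ennreal) (simp add: nonneg)
  ultimately show ?thesis
    by simp
qed

end

theorem theorem3p11:
  fixes x :: "nat \<Rightarrow> real"
  assumes "\<forall>i. x i \<ge> 0" and "x sums 1" and "x 0 > 0"
  shows "invariant_measure (imjmc x) (\<lambda>l. ennreal (juggling_weight x l)) \<and>
    total_mass (\<lambda>l. ennreal (juggling_weight x l)) =
      (\<Prod>m. ennreal (1 / (1 - tail_sum x (Suc m)))) \<and>
    ((\<Prod>m. ennreal (1 / (1 - tail_sum x (Suc m)))) < \<infinity> \<longleftrightarrow>
      positive_recurrent_chain (imjmc x)) \<and>
    ((\<Prod>m. ennreal (1 / (1 - tail_sum x (Suc m)))) < \<infinity> \<longleftrightarrow>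
      summable (\<lambda>i. real i * x i))"
proof -
  have nonneg: "\<And>i. x i \<ge> 0"
    using assms(1) by blast
  note inv = invariant_measure_juggling_weight[OF nonneg assms(2,3)]
  note mass = total_mass_juggling_weight[OF nonneg assms(2,3)]
  have acc: "accessible (imjmc x) l empty_par" for l
    by (rule accessible_empty_par[OF nonneg assms(2,3)])
  show ?thesis
    \<comment> \<open>Reading the product as the total mass turns both equivalences into statements
      about the invariant measure.\<close>
    unfolding mass[symmetric] positive_recurrent_chain_iff_total_mass[OF inv acc]
      total_mass_juggling_weight_finite_iff[OF nonneg assms(2,3)]
      summable_tail_sum_iff[OF nonneg assms(2,3)]
    using inv by simp
qed

end
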